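(* The class $\mathcal{CQT}$, equipped with the norm $\|\cdot\|_{\mathcal{CQT}}$ (and with matrix addition, scalar multiplication and rows-by-columns matrix multiplication), is a Banach algebra over $\mathbb C$. Moreover $\|AB\|_{\mathcal{CQT}}\le\|A\|_{\mathcal{CQT}}\,\|B\|_{\mathcal{CQT}}$ for any matrices $A,B\in\mathcal{CQT}$.
   Context: $\mathbb T=\{z\in\mathbb C: |z|=1\}$ and $\mathbb Z^+$ is the set of positive integers. The Wiener class $\mathcal W$ is the set of functions $a(z)=\sum_{i\in\mathbb Z}a_iz^i:\mathbb T\to\mathbb C$ with $\|a\|_{\mathcal W}:=\sum_{i\in\mathbb Z}|a_i|<\infty$. $\mathcal W_1$ is the set of $a\in\mathcal W$ that are continuous and such that $a'(z)=\sum_{i\in\mathbb Z}ia_iz^{i-1}\in\mathcal W$; its norm is $\|a\|_{\mathcal W_1}=\|a\|_{\mathcal W}+\|a'\|_{\mathcal W}$. For $a\in\mathcal W$, $T(a)=(t_{i,j})_{i,j\in\mathbb Z^+}$ is the semi-infinite Toeplitz matrix with $t_{i,j}=a_{j-i}$. $\mathcal F$ is the set of semi-infinite complex matrices $F=(f_{i,j})_{i,j\in\mathbb Z^+}$ with $\|F\|_{\mathcal F}:=\sum_{i,j\in\mathbb Z^+}|f_{i,j}|<\infty$. A CQT-matrix is a semi-infinite matrix of the form $A=T(a)+E$ with $a\in\mathcal W_1$ and $E\in\mathcal F$ (this decomposition is unique); $\mathcal{CQT}$ is the set of all CQT-matrices, and $\|T(a)+E\|_{\mathcal{CQT}}:=\|a\|_{\mathcal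 W_1}+\|E\|_{\mathcal F}=\|a\|_{\mathcal W}+\|a'\|_{\mathcal W}+\|E\|_{\mathcal F}$. *)

theory Defs
  imports "HOL-Analysis.Analysis" "HOL-Library.Function_Algebras"
begin

section \<open>The Wiener class\<close>

abbreviation unit_circle :: "complex set" where
  "unit_circle \<equiv> sphere 0 1"

text \<open>
  Functions from the unit circle to the complex numbers are modelled by total functions that are
  \<open>undefined\<close> off the circle, so that equality of symbols is equality on the circle.
\<close>

definition wiener_expansion :: "(complex \<Rightarrow> complex) \<Rightarrow> (int \<Rightarrow> complex) \<Rightarrow> bool" where
  "wiener_expansion a c \<longleftrightarrow>
     (\<lambda>i. norm (c i)) summable_on UNIV \<and>
     (\<forall>z\<in>unit_circle. ((\<lambda>i. c i * z powi i) has_sum a z) UNIV)"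

definition wiener :: "(complex \<Rightarrow> complex) set" where
  "wiener = {a \<in> extensional unit_circle. \<exists>c. wiener_expansion a c}"

text \<open>The coefficients of a function in the Wiener class are uniquely determined by it.\<close>

definition wiener_coeff :: "(complex \<Rightarrow> complex) \<Rightarrow> int \<Rightarrow> complex" where
  "wiener_coeff a = (THE c. wiener_expansion a c)"

definition wiener_norm :: "(complex \<Rightarrow> complex) \<Rightarrow> real" where
  "wiener_norm a = (\<Sum>\<^sub>\<infinity>i. norm (wiener_coeff a i))"

definition wiener_deriv :: "(complex \<Rightarrow> complex) \<Rightarrow> complex \<Rightarrow> complex" where
  "wiener_deriv a =
     (\<lambda>z\<in>unit_circle. \<Sum>\<^sub>\<infinity>i. of_int i * wiener_coeff a i * z powi (i - 1))"

text \<open>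
  Summability of the derived series must be required separately: \<open>infsum\<close> is \<open>0\<close> where the series
  does not converge, and the zero function belongs to the Wiener class.
\<close>

definition wiener1 :: "(complex \<Rightarrow> complex) set" where
  "wiener1 = {a \<in> wiener. continuous_on unit_circle a \<and>
     (\<forall>z\<in>unit_circle.
        (\<lambda>i. of_int i * wiener_coeff a i * z powi (i - 1)) summable_on UNIV) \<and>
     wiener_deriv a \<in> wiener}"

definition wiener1_norm :: "(complex \<Rightarrow> complex) \<Rightarrow> real" where
  "wiener1_norm a = wiener_norm a + wiener_norm (wiener_deriv a)"


section \<open>Semi-infinite matrices\<close>

text \<open>
  Rows and columns are numbered from 0: the entry of a matrix at the positive integers
  \<open>(i + 1, j + 1)\<close> is \<open>A i j\<close>. Addition, negation and zero are the pointwise operations of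
  the theory \<open>Function_Algebras\<close>; the pointwise product \<open>*\<close> provided there is
  \<^emph>\<open>not\<close> the matrix product.
\<close>

type_synonym infmat = "nat \<Rightarrow> nat \<Rightarrow> complex"

definition mat_scale :: "complex \<Rightarrow> infmat \<Rightarrow> infmat" where
  "mat_scale c A = (\<lambda>i j. c * A i j)"

definition mat_mult :: "infmat \<Rightarrow> infmat \<Rightarrow> infmat" where
  "mat_mult A B = (\<lambda>i j. \<Sum>\<^sub>\<infinity>k. A i k * B k j)"

text \<open>All the series defining the entries of the matrix product converge.\<close>

definition mat_mult_defined :: "infmat \<Rightarrow> infmat \<Rightarrow> bool" where
  "mat_mult_defined A B \<longleftrightarrow> (\<forall>i j. (\<lambda>k. A i k * B k j) summable_on UNIV)"

definition toeplitz :: "(complex \<Rightarrow> complex) \<Rightarrow> infmat" where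
  "toeplitz a = (\<lambda>i j. wiener_coeff a (int j - int i))"

definition fin_mats :: "infmat set" where
  "fin_mats = {F. (\<lambda>(i, j). norm (F i j)) summable_on UNIV}"

definition fin_norm :: "infmat \<Rightarrow> real" where
  "fin_norm F = (\<Sum>\<^sub>\<infinity>(i, j). norm (F i j))"


section \<open>CQT matrices\<close>

definition CQT :: "infmat set" where
  "CQT = {toeplitz a + E | a E. a \<in> wiener1 \<and> E \<in> fin_mats}"

text \<open>The description is proper because the symbol and the correction are unique.\<close>

definition cqt_norm :: "infmat \<Rightarrow> real" where
  "cqt_norm A = (THE r. \<exists>a\<in>wiener1. \<exists>E\<in>fin_mats.
     A = toeplitz a + E \<and> r = wiener1_norm a + fin_norm E)"


section \<open>Complex Banach algebras on a carrier\<close>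

text \<open>
  The carrier is a subspace of an ambient complex vector space; the product and the norm need only
  be well behaved on it. As usual, a unit is not part of the definition.
\<close>

locale complex_banach_algebra_on = vector_space scale
  for scale :: "complex \<Rightarrow> 'a::ab_group_add \<Rightarrow> 'a" +
  fixes S :: "'a set"
    and mult :: "'a \<Rightarrow> 'a \<Rightarrow> 'a"
    and nrm :: "'a \<Rightarrow> real"
  assumes subspace_carrier: "subspace S"
    and mult_closed: "\<lbrakk>x \<in> S; y \<in> S\<rbrakk> \<Longrightarrow> mult x y \<in> S"
    and mult_assoc:
      "\<lbrakk>x \<in> S; y \<in> S; z \<in> S\<rbrakk> \<Longrightarrow> mult (mult x y) z = mult x (mult y z)"
    and mult_add_left:
      "\<lbrakk>x \<in> S; y \<in> S; z \<in> S\<rbrakk> \<Longrightarrow> mult (x + y) z = mult x z + mult y z"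
    and mult_add_right:
      "\<lbrakk>x \<in> S; y \<in> S; z \<in> S\<rbrakk> \<Longrightarrow> mult x (y + z) = mult x y + mult x z"
    and mult_scale_left: "\<lbrakk>x \<in> S; y \<in> S\<rbrakk> \<Longrightarrow> mult (scale c x) y = scale c (mult x y)"
    and mult_scale_right: "\<lbrakk>x \<in> S; y \<in> S\<rbrakk> \<Longrightarrow> mult x (scale c y) = scale c (mult x y)"
    and nrm_nonneg: "x \<in> S \<Longrightarrow> 0 \<le> nrm x"
    and nrm_eq_0_iff: "x \<in> S \<Longrightarrow> nrm x = 0 \<longleftrightarrow> x = 0"
    and nrm_triangle: "\<lbrakk>x \<in> S; y \<in> S\<rbrakk> \<Longrightarrow> nrm (x + y) \<le> nrm x + nrm y"
    and nrm_scale: "x \<in> S \<Longrightarrow> nrm (scale c x) = norm c * nrm x"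
    and nrm_mult: "\<lbrakk>x \<in> S; y \<in> S\<rbrakk> \<Longrightarrow> nrm (mult x y) \<le> nrm x * nrm y"
    and nrm_complete:
      "\<lbrakk>\<And>n::nat. X n \<in> S;
        \<And>e. 0 < e \<Longrightarrow> \<exists>N. \<forall>m\<ge>N. \<forall>n\<ge>N. nrm (X m - X n) < e\<rbrakk>
       \<Longrightarrow> \<exists>L\<in>S. (\<lambda>n. nrm (X n - L)) \<longlonglongrightarrow> 0"

end

theory Submission
  imports Defs
begin

text \<open>
  All assertions are transported from a weighted \<open>l\<^sup>1\<close> space of coordinates. A CQT matrix
  \<open>T(a) + E\<close> is recorded by the Fourier coefficients of \<open>a\<close> together with the entries of \<open>E\<close>,
  a single family \<open>u\<close> indexed by \<open>int + nat \<times> nat\<close>. Since \<open>a'\<close> has coefficients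
  \<open>(i + 1) a\<^bsub>i+1\<^esub>\<close>, the CQT norm is the sum of the \<open>\<bar>u p\<bar>\<close> with weight \<open>1 + \<bar>i\<bar>\<close> at the
  diagonal number \<open>i\<close> and weight \<open>1\<close> at a single entry. This reading needs the coefficients to
  be determined by \<open>a\<close> (\<open>wiener_coeff_eqI\<close>) and the coordinates to be determined by the matrix
  (\<open>inj_on_cqt_matrix\<close>: a nonzero constant along a diagonal is not summable). The vector space
  structure, the norm axioms and completeness are then those of the weighted space (\<open>wl1_complete\<close>).

  For the product, call the matrices with one coordinate equal to \<open>1\<close> and the others \<open>0\<close>
  basis matrices: the shifts \<open>T\<^sub>r\<close>, with ones on the diagonal number \<open>r\<close>, and the matrix
  units. The product of two basis matrices is a finite combination of basis matrices whose norm
  is at most the product of the two weights (\<open>structure_const_wl1\<close>). Apart from trivial cases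
  this concerns \<open>T\<^sub>r T\<^sub>s\<close>, which differs from \<open>T\<^bsub>r+s\<^esub>\<close> by matrix units, one for each path
  through a negative intermediate index; there are at most \<open>\<bar>r\<bar> \<bar>s\<bar>\<close> of them, and
  \<open>1 + \<bar>r + s\<bar> + \<bar>r\<bar> \<bar>s\<bar> \<le> (1 + \<bar>r\<bar>) (1 + \<bar>s\<bar>)\<close>. A bilinear product whose structure
  constants satisfy such a bound extends to the whole weighted space with constant \<open>1\<close>
  (\<open>wl1_bilinear_ext\<close>), and by Fubini the extension computes the matrix product
  (\<open>cqt_matrix_product_has_sum\<close>). Associativity is again Fubini, because rows and columns of
  CQT matrices are summable and their entries bounded.
\<close>

section \<open>Fourier coefficients of Wiener functions\<close>

lemma sum_powers_root_of_unity:
  fixes N :: nat and m :: int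
  assumes "N > 0"
  shows "(\<Sum>k<N. (cis (2 * pi / real N) ^ k) powi m) = (if int N dvd m then of_nat N else 0)"
proof -
  define x where "x = cis (2 * pi / real N) powi m"
  have x: "x = cis (2 * pi * (real_of_int m / real N))"
    by (simp add: x_def cis_power_int field_simps)
  have "(cis (2 * pi / real N) ^ k) powi m = x ^ k" for k
    by (simp add: x_def power_int_power power_int_power' mult.commute)
  hence sum_eq: "(\<Sum>k<N. (cis (2 * pi / real N) ^ k) powi m) = (\<Sum>k<N. x ^ k)"
    by simp
  show ?thesis
  proof (cases "int N dvd m")
    case True
    then obtain q where "m = int N * q" by (auto elim: dvdE)
    hence "x = 1"
      using assms by (simp add: x)
    thus ?thesis
      using True by (simp add: sum_eq)
  next
    case False
    have "x \<noteq> 1"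
    proof
      assume "x = 1"
      hence "cos (2 * pi * (real_of_int m / real N)) = 1"
        by (metis x cis.sel(1) one_complex.sel(1))
      then obtain q :: int where "2 * pi * (real_of_int m / real N) = of_int q * 2 * pi"
        using cos_one_2pi_int by blast
      hence "real_of_int m = of_int (q * int N)"
        using assms by (simp add: field_simps)
      hence "m = q * int N"
        by (simp only: of_int_eq_iff)
      thus False
        using False by simp
    qed
    moreover have "x ^ N = 1"
    proof -
      have "x ^ N = cis (2 * pi * real_of_int m)"
        using assms by (simp add: x Complex.DeMoivre field_simps)
      thus ?thesis by simp
    qed
    ultimately show ?thesis
      using False by (simp add: sum_eq geometric_sum)
  qed
qed

lemma has_sum_finite_sum:
  fixes f :: "'k \<Rightarrow> 'a \<Rightarrow> 'b :: topological_comm_monoid_add"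
  assumes "finite K" "\<And>k. k \<in> K \<Longrightarrow> (f k has_sum s k) A"
  shows "((\<lambda>x. \<Sum>k\<in>K. f k x) has_sum (\<Sum>k\<in>K. s k)) A"
  using assms by (induction K rule: finite_induct) (auto intro: has_sum_add)

text \<open>
  Averaging over the \<open>N\<close>-th roots of unity replaces the Fourier integral: it isolates the
  coefficients in one residue class modulo \<open>N\<close>, and only finite sums have to be exchanged with
  the series.
\<close>
lemma wiener_expansion_average:
  fixes N :: nat and j :: int
  assumes a: "wiener_expansion a c" and N: "N > 0"
  defines "\<omega> \<equiv> cis (2 * pi / real N)"
  shows "(c has_sum (\<Sum>k<N. a (\<omega> ^ k) * (\<omega> ^ k) powi (-j)) / of_nat N) {i. int N dvd i - j}"
proof -
  have circle: "\<omega> ^ k \<in> unit_circle" for k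
    by (simp add: \<omega>_def norm_power)
  have nz: "\<omega> ^ k \<noteq> 0" for k
    by (simp add: \<omega>_def)
  have "((\<lambda>i. c i * (\<omega> ^ k) powi i * (\<omega> ^ k) powi (-j)) has_sum a (\<omega> ^ k) * (\<omega> ^ k) powi (-j)) UNIV" for k
    using a circle[of k] by (intro has_sum_cmult_left) (auto simp: wiener_expansion_def)
  hence "((\<lambda>i. \<Sum>k<N. c i * (\<omega> ^ k) powi i * (\<omega> ^ k) powi (-j)) has_sum
          (\<Sum>k<N. a (\<omega> ^ k) * (\<omega> ^ k) powi (-j))) UNIV"
    by (intro has_sum_finite_sum) auto
  moreover have "(\<Sum>k<N. c i * (\<omega> ^ k) powi i * (\<omega> ^ k) powi (-j)) =
      (if int N dvd i - j then c i * of_nat N else 0)" for i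
  proof -
    have "(\<Sum>k<N. c i * (\<omega> ^ k) powi i * (\<omega> ^ k) powi (-j)) = c i * (\<Sum>k<N. (\<omega> ^ k) powi (i - j))"
      unfolding sum_distrib_left
      using nz by (intro sum.cong refl) (simp add: power_int_diff power_int_minus divide_inverse)
    thus ?thesis
      using sum_powers_root_of_unity[OF N, of "i - j"] by (simp add: \<omega>_def)
  qed
  ultimately have "((\<lambda>i. if int N dvd i - j then c i * of_nat N else 0) has_sum
          (\<Sum>k<N. a (\<omega> ^ k) * (\<omega> ^ k) powi (-j))) UNIV"
    by simp
  hence "((\<lambda>i. c i * of_nat N) has_sum (\<Sum>k<N. a (\<omega> ^ k) * (\<omega> ^ k) powi (-j))) {i. int N dvd i - j}"
    by (rule has_sum_cong_neutral[THEN iffD1, rotated -1]) auto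
  thus ?thesis
    using N by (subst (asm) has_sum_cmult_left_iff) auto
qed

text \<open>
  As \<open>N\<close> grows, the residue class of \<open>j\<close> loses every index other than \<open>j\<close> to infinity, so the
  averages tend to \<open>c j\<close>. The averages depend on \<open>a\<close> alone, which makes the coefficients unique.
\<close>
lemma wiener_expansion_coeff_limit:
  assumes a: "wiener_expansion a c"
  shows "(\<lambda>N. (\<Sum>k<N. a (cis (2 * pi / real N) ^ k) * (cis (2 * pi / real N) ^ k) powi (-j)) / of_nat N)
           \<longlonglongrightarrow> c j"
    (is "?A \<longlonglongrightarrow> _")
proof (rule LIMSEQ_I)
  fix e :: real assume e: "0 < e"
  have summ: "(\<lambda>i. norm (c i)) summable_on UNIV"
    using a by (simp add: wiener_expansion_def)
  obtain F where F: "finite F"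
    and F_approx: "dist (\<Sum>i\<in>F. norm (c i)) (\<Sum>\<^sub>\<infinity>i. norm (c i)) \<le> e / 2"
    using infsum_finite_approximation[OF summ, of "e / 2"] e by auto
  have "(\<Sum>\<^sub>\<infinity>i\<in>UNIV - F. norm (c i)) = (\<Sum>\<^sub>\<infinity>i. norm (c i)) - (\<Sum>i\<in>F. norm (c i))"
    using infsum_Diff[OF summ, of F] F by simp
  hence tail: "(\<Sum>\<^sub>\<infinity>i\<in>- F. norm (c i)) < e"
    using F_approx e unfolding dist_real_def Compl_eq_Diff_UNIV by linarith
  define N0 where "N0 = nat (Max (insert 0 ((\<lambda>i. \<bar>i - j\<bar>) ` F))) + 1"
  have N0: "\<bar>i - j\<bar> < int N0" if "i \<in> F" for i
  proof -
    have "\<bar>i - j\<bar> \<le> Max (insert 0 ((\<lambda>i. \<bar>i - j\<bar>) ` F))"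
      using that F by (intro Max_ge) auto
    moreover have "0 \<le> Max (insert 0 ((\<lambda>i. \<bar>i - j\<bar>) ` F))"
      using F by (intro Max_ge) auto
    ultimately show ?thesis by (simp add: N0_def)
  qed
  show "\<exists>n0. \<forall>N\<ge>n0. norm (?A N - c j) < e"
  proof (intro exI allI impI)
    fix N assume N: "N0 \<le> N"
    define G where "G = {i. int N dvd i - j}"
    have "N > 0" using N by (simp add: N0_def)
    from wiener_expansion_average[OF a this, of j]
    have "(c has_sum ?A N) G" by (simp add: G_def)
    hence S: "(c has_sum (?A N - c j)) (G - {j})"
      by (rule has_sum_Diff) (auto simp: G_def intro: has_sum_finiteI)
    \<comment> \<open>Apart from \<open>j\<close>, every index congruent to \<open>j\<close> modulo \<open>N\<close> is at distance at least \<open>N\<close>.\<close>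
    have disj: "G - {j} \<subseteq> - F"
    proof
      fix i assume i: "i \<in> G - {j}"
      hence "int N \<le> \<bar>i - j\<bar>"
        by (intro zdvd_imp_le) (auto simp: G_def)
      thus "i \<in> - F"
        using N0[of i] N by auto
    qed
    have summ': "(\<lambda>i. norm (c i)) summable_on A" for A
      using summ summable_on_subset_banach by blast
    have "norm (?A N - c j) \<le> (\<Sum>\<^sub>\<infinity>i\<in>G - {j}. norm (c i))"
      using norm_infsum_bound[OF summ'] infsumI[OF S] by metis
    also have "\<dots> \<le> (\<Sum>\<^sub>\<infinity>i\<in>- F. norm (c i))"
      using disj by (intro infsum_mono2 summ') auto
    also have "\<dots> < e" by (rule tail)
    finally show "norm (?A N - c j) < e" .
  qed
qed

lemma wiener_coeff_eqI:
  assumes "wiener_expansion a c"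
  shows "wiener_coeff a = c"
  unfolding wiener_coeff_def
proof (rule the_equality)
  fix d assume "wiener_expansion a d"
  show "d = c"
  proof
    show "d j = c j" for j
      using wiener_expansion_coeff_limit[OF \<open>wiener_expansion a d\<close>, of j]
        wiener_expansion_coeff_limit[OF assms, of j] LIMSEQ_unique by blast
  qed
qed fact


section \<open>Symbols with prescribed coefficients\<close>

definition symbol :: "(int \<Rightarrow> complex) \<Rightarrow> complex \<Rightarrow> complex" where
  "symbol c = (\<lambda>z\<in>unit_circle. \<Sum>\<^sub>\<infinity>i. c i * z powi i)"

lemma norm_mult_powi_unit_circle:
  "z \<in> unit_circle \<Longrightarrow> norm (x * z powi i) = norm x"
  by (simp add: norm_mult norm_power_int)

lemma wiener_expansion_symbol:
  assumes "(\<lambda>i. norm (c i)) summable_on UNIV"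
  shows "wiener_expansion (symbol c) c"
  unfolding wiener_expansion_def
proof (intro conjI ballI)
  fix z assume z: "z \<in> unit_circle"
  have "(\<lambda>i. norm (c i * z powi i)) summable_on UNIV"
    using assms by (simp add: norm_mult_powi_unit_circle[OF z])
  hence "(\<lambda>i. c i * z powi i) summable_on UNIV"
    by (rule abs_summable_summable)
  thus "((\<lambda>i. c i * z powi i) has_sum symbol c z) UNIV"
    using z by (simp add: symbol_def)
qed fact

lemma symbol_in_wiener: "(\<lambda>i. norm (c i)) summable_on UNIV \<Longrightarrow> symbol c \<in> wiener"
  using wiener_expansion_symbol[of c] by (auto simp: wiener_def symbol_def)

lemma wiener_norm_eqI: "wiener_expansion a c \<Longrightarrow> wiener_norm a = (\<Sum>\<^sub>\<infinity>i. norm (c i))"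
  by (simp add: wiener_norm_def wiener_coeff_eqI)

lemma wiener_expansion_wiener_coeff: "a \<in> wiener \<Longrightarrow> wiener_expansion a (wiener_coeff a)"
  by (auto simp: wiener_def wiener_coeff_eqI)

lemma continuous_on_symbol:
  assumes "(\<lambda>i. norm (c i)) summable_on UNIV"
  shows "continuous_on unit_circle (symbol c)"
proof (rule uniform_limit_theorem)
  show "uniform_limit unit_circle (\<lambda>I z. \<Sum>i\<in>I. c i * z powi i) (symbol c) (finite_subsets_at_top UNIV)"
  proof (rule Weierstrass_m_test_general')
    show "norm (c i * z powi i) \<le> norm (c i)" if "z \<in> unit_circle" for i z
      using that by (simp add: norm_mult_powi_unit_circle)
    show "((\<lambda>i. c i * z powi i) has_sum symbol c z) UNIV" if "z \<in> unit_circle" for z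
      using wiener_expansion_symbol[OF assms] that by (simp add: wiener_expansion_def)
  qed fact
  show "\<forall>\<^sub>F I in finite_subsets_at_top UNIV. continuous_on unit_circle (\<lambda>z. \<Sum>i\<in>I. c i * z powi i)"
    by (intro always_eventually allI continuous_intros) auto
qed auto


section \<open>Derivatives and the class of differentiable symbols\<close>

lemma int_weight_abs_summable:
  fixes c :: "int \<Rightarrow> complex"
  assumes "(\<lambda>i. (1 + \<bar>real_of_int i\<bar>) * norm (c i)) summable_on UNIV"
  shows "(\<lambda>i. norm (c i)) summable_on UNIV" "(\<lambda>i. \<bar>real_of_int i\<bar> * norm (c i)) summable_on UNIV"
  by (rule summable_on_comparison_test[OF assms]; simp add: algebra_simps)+

lemma wiener_deriv_series_summable:
  assumes a: "wiener_expansion a c" and c: "(\<lambda>i. \<bar>real_of_int i\<bar> * norm (c i)) summable_on UNIV"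
    and z: "z \<in> unit_circle"
  shows "(\<lambda>i. of_int i * wiener_coeff a i * z powi (i - 1)) summable_on UNIV"
proof (rule abs_summable_summable)
  show "(\<lambda>i. norm (of_int i * wiener_coeff a i * z powi (i - 1))) summable_on UNIV"
    using c unfolding wiener_coeff_eqI[OF a] norm_mult_powi_unit_circle[OF z] by (simp add: norm_mult)
qed

lemma shift_bij: "bij (\<lambda>i::int. i + 1)"
  by (rule bij_betw_byWitness[where f' = "\<lambda>i. i - 1"]) auto

lemma wiener_deriv_eq_symbol:
  assumes a: "wiener_expansion a c"
  shows "wiener_deriv a = symbol (\<lambda>i. of_int (i + 1) * c (i + 1))"
  unfolding wiener_deriv_def symbol_def wiener_coeff_eqI[OF a]
  using infsum_reindex_bij_betw[OF shift_bij, of "\<lambda>i. of_int i * c i * _ powi (i - 1)"]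
  by (intro restrict_ext) simp

lemma wiener_expansion_wiener_deriv:
  assumes a: "wiener_expansion a c" and c: "(\<lambda>i. \<bar>real_of_int i\<bar> * norm (c i)) summable_on UNIV"
  shows "wiener_expansion (wiener_deriv a) (\<lambda>i. of_int (i + 1) * c (i + 1))"
  unfolding wiener_deriv_eq_symbol[OF a]
proof (rule wiener_expansion_symbol)
  show "(\<lambda>i. norm (of_int (i + 1) * c (i + 1))) summable_on UNIV"
    using c summable_on_reindex_bij_betw[OF shift_bij, of "\<lambda>i. norm (of_int i * c i)"]
    by (simp only: norm_mult norm_of_int)
qed

lemma wiener_norm_wiener_deriv:
  assumes a: "wiener_expansion a c" and c: "(\<lambda>i. \<bar>real_of_int i\<bar> * norm (c i)) summable_on UNIV"
  shows "wiener_norm (wiener_deriv a) = (\<Sum>\<^sub>\<infinity>i. \<bar>real_of_int i\<bar> * norm (c i))"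
  unfolding wiener_norm_eqI[OF wiener_expansion_wiener_deriv[OF a c]]
  using infsum_reindex_bij_betw[OF shift_bij, of "\<lambda>i. norm (of_int i * c i)"]
  by (simp only: norm_mult norm_of_int)

text \<open>
  In \<open>\<complex>\<close> unconditional convergence is absolute convergence, so convergence of the derived
  series at the single point \<open>1\<close> already makes the weighted coefficient family summable.
\<close>
lemma wiener1_coeff:
  assumes "a \<in> wiener1"
  shows "(\<lambda>i. (1 + \<bar>real_of_int i\<bar>) * norm (wiener_coeff a i)) summable_on UNIV"
    and "wiener1_norm a = (\<Sum>\<^sub>\<infinity>i. (1 + \<bar>real_of_int i\<bar>) * norm (wiener_coeff a i))"
proof -
  define c where "c = wiener_coeff a"
  have a: "wiener_expansion a c"
    using assms by (simp add: c_def wiener1_def wiener_expansion_wiener_coeff)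
  hence 1: "(\<lambda>i. norm (c i)) summable_on UNIV"
    by (simp add: wiener_expansion_def)
  have "(\<lambda>i. of_int i * c i * 1 powi (i - 1)) summable_on UNIV"
    using assms unfolding wiener1_def c_def by (auto dest: bspec[where x = 1] simp del: power_int_1_left)
  hence 2: "(\<lambda>i. \<bar>real_of_int i\<bar> * norm (c i)) summable_on UNIV"
    by (simp add: summable_on_iff_abs_summable_on_complex norm_mult)
  have split: "(1 + \<bar>real_of_int i\<bar>) * norm (c i) = norm (c i) + \<bar>real_of_int i\<bar> * norm (c i)" for i
    by (simp add: algebra_simps)
  show "(\<lambda>i. (1 + \<bar>real_of_int i\<bar>) * norm (wiener_coeff a i)) summable_on UNIV"
    unfolding c_def[symmetric] split by (intro summable_on_add 1 2)
  show "wiener1_norm a = (\<Sum>\<^sub>\<infinity>i. (1 + \<bar>real_of_int i\<bar>) * norm (wiener_coeff a i))"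
    unfolding c_def[symmetric] split wiener1_norm_def wiener_norm_eqI[OF a] wiener_norm_wiener_deriv[OF a 2]
    by (intro infsum_add[symmetric] 1 2)
qed

lemma symbol_in_wiener1:
  assumes "(\<lambda>i. (1 + \<bar>real_of_int i\<bar>) * norm (c i)) summable_on UNIV"
  shows "symbol c \<in> wiener1"
proof -
  note c = int_weight_abs_summable[OF assms]
  note a = wiener_expansion_symbol[OF c(1)]
  have "wiener_deriv (symbol c) \<in> wiener"
    using wiener_expansion_wiener_deriv[OF a c(2)] by (auto simp: wiener_def wiener_deriv_def)
  thus ?thesis
    using wiener_deriv_series_summable[OF a c(2)] symbol_in_wiener[OF c(1)] continuous_on_symbol[OF c(1)]
    by (simp add: wiener1_def)
qed


section \<open>Double series with nonnegative terms\<close>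

text \<open>
  Tonelli: for nonnegative terms, summability of the iterated series in one order carries
  over to the double series and to the other order.
\<close>
lemma nonneg_Fubini:
  fixes f :: "'a \<Rightarrow> 'b \<Rightarrow> real"
  assumes nonneg: "\<And>x y. 0 \<le> f x y"
    and inner: "\<And>x. (f x has_sum g x) UNIV" and outer: "g summable_on UNIV"
  shows "(\<lambda>(x, y). f x y) summable_on UNIV"
    and "(\<lambda>x. f x y) summable_on UNIV"
    and "((\<lambda>y. \<Sum>\<^sub>\<infinity>x. f x y) has_sum (\<Sum>\<^sub>\<infinity>x. g x)) UNIV"
proof -
  have summ: "(\<lambda>(x, y). f x y) summable_on UNIV \<times> UNIV"
    by (rule summable_on_SigmaI[where g = g]) (use assms in auto)
  thus "(\<lambda>(x, y). f x y) summable_on UNIV"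
    by simp
  have "((\<lambda>(x, y). f x y) has_sum (\<Sum>\<^sub>\<infinity>x. g x)) (UNIV \<times> UNIV)"
    by (rule has_sum_SigmaI[where g = g]) (use inner outer summ in auto)
  hence swapped: "((\<lambda>(y, x). f x y) has_sum (\<Sum>\<^sub>\<infinity>x. g x)) (UNIV \<times> UNIV)"
    by (subst (asm) has_sum_swap) simp
  hence slice: "(\<lambda>x. f x y) summable_on UNIV" for y
    using summable_on_SigmaD1[OF has_sum_imp_summable[OF swapped], of y] by simp
  thus "(\<lambda>x. f x y) summable_on UNIV" .
  show "((\<lambda>y. \<Sum>\<^sub>\<infinity>x. f x y) has_sum (\<Sum>\<^sub>\<infinity>x. g x)) UNIV"
    by (rule has_sum_SigmaD[OF swapped]) (use slice in simp)
qed

lemma has_sum_product_nonneg: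
  fixes f :: "'a \<Rightarrow> real" and g :: "'b \<Rightarrow> real"
  assumes f: "(f has_sum F) UNIV" "\<And>x. 0 \<le> f x" and g: "(g has_sum G) UNIV" "\<And>y. 0 \<le> g y"
  shows "((\<lambda>(x, y). f x * g y) has_sum F * G) UNIV"
proof -
  have inner: "((\<lambda>y. f x * g y) has_sum f x * G) UNIV" for x
    by (intro has_sum_cmult_right g)
  have outer: "((\<lambda>x. f x * G) has_sum F * G) UNIV"
    by (intro has_sum_cmult_left f)
  have "(\<lambda>(x, y). f x * g y) summable_on UNIV \<times> UNIV"
    by (rule summable_on_SigmaI[where g = "\<lambda>x. f x * G"])
      (use inner outer f(2) g(2) has_sum_imp_summable in auto)
  from has_sum_SigmaI[OF _ outer this] show ?thesis
    using inner by simp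
qed

lemma summable_on_subset_UNIV:
  fixes f :: "'a \<Rightarrow> 'b :: banach"
  shows "f summable_on UNIV \<Longrightarrow> f summable_on A"
  using summable_on_subset_banach by blast


section \<open>Weighted spaces of summable families\<close>

definition wl1 :: "('a \<Rightarrow> real) \<Rightarrow> ('a \<Rightarrow> complex) set" where
  "wl1 w = {u. (\<lambda>p. w p * norm (u p)) summable_on UNIV}"

definition wl1_norm :: "('a \<Rightarrow> real) \<Rightarrow> ('a \<Rightarrow> complex) \<Rightarrow> real" where
  "wl1_norm w u = (\<Sum>\<^sub>\<infinity>p. w p * norm (u p))"

text \<open>
  \<open>K p q k\<close> is the coefficient of the \<open>k\<close>-th basis vector in the product of the \<open>p\<close>-th and the
  \<open>q\<close>-th one.
\<close>
definition bilinear_ext ::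
  "('a \<Rightarrow> 'a \<Rightarrow> 'a \<Rightarrow> complex) \<Rightarrow> ('a \<Rightarrow> complex) \<Rightarrow> ('a \<Rightarrow> complex) \<Rightarrow> 'a \<Rightarrow> complex" where
  "bilinear_ext K u v k = (\<Sum>\<^sub>\<infinity>(p, q). u p * v q * K p q k)"

text \<open>
  The lower bound makes the weighted norm dominate the plain \<open>l\<^sup>1\<close> norm.
\<close>
locale l1_weight =
  fixes w :: "'a \<Rightarrow> real"
  assumes weight_ge_1: "1 \<le> w p"
begin

lemma weight_pos: "0 < w p" and weight_nonneg: "0 \<le> w p"
  using weight_ge_1[of p] by simp_all

lemma wl1_has_sum: "u \<in> wl1 w \<Longrightarrow> ((\<lambda>p. w p * norm (u p)) has_sum wl1_norm w u) UNIV"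
  by (simp add: wl1_def wl1_norm_def)

lemma wl1_norm_nonneg: "0 \<le> wl1_norm w u"
  unfolding wl1_norm_def by (intro infsum_nonneg mult_nonneg_nonneg weight_nonneg) simp

lemma wl1_coord_le:
  assumes "u \<in> wl1 w"
  shows "w p * norm (u p) \<le> wl1_norm w u"
  using finite_sum_le_has_sum[OF wl1_has_sum[OF assms], of "{p}"] weight_nonneg by simp

lemma wl1_norm_coord_le:
  assumes "u \<in> wl1 w"
  shows "norm (u p) \<le> wl1_norm w u"
proof -
  have "1 * norm (u p) \<le> w p * norm (u p)"
    by (intro mult_right_mono weight_ge_1) simp
  thus ?thesis using wl1_coord_le[OF assms, of p] by simp
qed

lemma wl1_abs_summable:
  assumes "u \<in> wl1 w"
  shows "(\<lambda>p. norm (u p)) summable_on UNIV"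
proof (rule summable_on_comparison_test)
  show "(\<lambda>p. w p * norm (u p)) summable_on UNIV"
    using assms by (simp add: wl1_def)
  show "norm (u p) \<le> w p * norm (u p)" for p
    using mult_right_mono[OF weight_ge_1[of p], of "norm (u p)"] by simp
qed simp

lemma wl1_norm_eq_0:
  assumes "u \<in> wl1 w" "wl1_norm w u = 0"
  shows "u = 0"
proof
  fix p show "u p = 0 p"
    using wl1_norm_coord_le[OF assms(1), of p] assms(2) by simp
qed

lemma wl1_norm_le:
  assumes "\<And>F. finite F \<Longrightarrow> (\<Sum>p\<in>F. w p * norm (u p)) \<le> C"
  shows "u \<in> wl1 w" "wl1_norm w u \<le> C"
proof -
  have "(\<lambda>p. w p * norm (u p)) summable_on UNIV"
    by (rule nonneg_bdd_above_summable_on)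
      (use assms weight_nonneg in \<open>auto intro!: bdd_aboveI2\<close>)
  thus "u \<in> wl1 w" "wl1_norm w u \<le> C"
    using assms by (auto simp: wl1_def wl1_norm_def intro: infsum_le_finite_sums)
qed

lemma wl1_0: "0 \<in> wl1 w" "wl1_norm w 0 = 0"
  by (simp_all add: wl1_def wl1_norm_def)

lemma wl1_scale:
  assumes "u \<in> wl1 w"
  shows "(\<lambda>p. c * u p) \<in> wl1 w" "wl1_norm w (\<lambda>p. c * u p) = norm c * wl1_norm w u"
proof -
  have "((\<lambda>p. norm c * (w p * norm (u p))) has_sum norm c * wl1_norm w u) UNIV"
    by (intro has_sum_cmult_right wl1_has_sum assms)
  hence "((\<lambda>p. w p * norm (c * u p)) has_sum norm c * wl1_norm w u) UNIV"
    by (simp add: norm_mult mult_ac)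
  thus "(\<lambda>p. c * u p) \<in> wl1 w" "wl1_norm w (\<lambda>p. c * u p) = norm c * wl1_norm w u"
    by (auto simp: wl1_def wl1_norm_def has_sum_iff)
qed

lemma wl1_add:
  assumes u: "u \<in> wl1 w" and v: "v \<in> wl1 w"
  shows "u + v \<in> wl1 w" "wl1_norm w (u + v) \<le> wl1_norm w u + wl1_norm w v"
proof -
  have sum: "((\<lambda>p. w p * norm (u p) + w p * norm (v p)) has_sum wl1_norm w u + wl1_norm w v) UNIV"
    by (intro has_sum_add wl1_has_sum u v)
  have le: "w p * norm ((u + v) p) \<le> w p * norm (u p) + w p * norm (v p)" for p
    using mult_left_mono[OF norm_triangle_ineq[of "u p" "v p"] weight_nonneg[of p]]
    by (simp add: distrib_left)
  have summ: "(\<lambda>p. w p * norm ((u + v) p)) summable_on UNIV"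
    by (rule summable_on_comparison_test[OF has_sum_imp_summable[OF sum] le])
      (simp add: weight_nonneg)
  thus "u + v \<in> wl1 w"
    by (simp add: wl1_def)
  show "wl1_norm w (u + v) \<le> wl1_norm w u + wl1_norm w v"
    unfolding wl1_norm_def[of w "u + v"]
    using has_sum_mono[OF has_sum_infsum[OF summ] sum] le by simp
qed

lemma wl1_diff:
  assumes "u \<in> wl1 w" "v \<in> wl1 w"
  shows "u - v \<in> wl1 w"
proof -
  have "u - v = u + (\<lambda>p. (-1) * v p)"
    by (auto simp: fun_eq_iff)
  thus ?thesis
    using wl1_add(1)[OF assms(1) wl1_scale(1)[OF assms(2), of "-1"]] by (simp only:)
qed

text \<open>
  The limit is taken coordinatewise; the Cauchy estimate holds on every finite set of coordinates,
  passes to the limit there, and finite sets control the norm by \<open>wl1_norm_le\<close>.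
\<close>
lemma wl1_complete:
  assumes X: "\<And>n::nat. X n \<in> wl1 w"
    and cauchy: "\<And>e. 0 < e \<Longrightarrow> \<exists>N. \<forall>m\<ge>N. \<forall>n\<ge>N. wl1_norm w (X m - X n) < e"
  shows "\<exists>L\<in>wl1 w. (\<lambda>n. wl1_norm w (X n - L)) \<longlonglongrightarrow> 0"
proof -
  have "Cauchy (\<lambda>n. X n p)" for p
  proof (rule CauchyI)
    fix e :: real assume "0 < e"
    then obtain N where N: "\<forall>m\<ge>N. \<forall>n\<ge>N. wl1_norm w (X m - X n) < e"
      using cauchy by blast
    have "norm (X m p - X n p) < e" if "m \<ge> N" "n \<ge> N" for m n
      using wl1_norm_coord_le[OF wl1_diff[OF X X], of m n p] N that by fastforce
    thus "\<exists>N. \<forall>m\<ge>N. \<forall>n\<ge>N. norm (X m p - X n p) < e" by blast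
  qed
  hence "\<exists>l. (\<lambda>n. X n p) \<longlonglongrightarrow> l" for p
    by (simp add: Cauchy_convergent_iff convergent_def)
  then obtain L where L: "\<And>p. (\<lambda>n. X n p) \<longlonglongrightarrow> L p" by metis
  have close: "\<exists>N. \<forall>n\<ge>N. X n - L \<in> wl1 w \<and> wl1_norm w (X n - L) \<le> e" if e: "0 < e" for e
  proof -
    obtain N where N: "\<forall>m\<ge>N. \<forall>n\<ge>N. wl1_norm w (X m - X n) < e"
      using cauchy[OF e] by blast
    have "(\<Sum>p\<in>F. w p * norm ((X n - L) p)) \<le> e" if n: "n \<ge> N" and F: "finite F" for n F
    proof (rule tendsto_upperbound)
      show "(\<lambda>m. \<Sum>p\<in>F. w p * norm (X n p - X m p)) \<longlonglongrightarrow> (\<Sum>p\<in>F. w p * norm ((X n - L) p))"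
        unfolding minus_apply by (intro tendsto_intros L)
      show "\<forall>\<^sub>F m in sequentially. (\<Sum>p\<in>F. w p * norm (X n p - X m p)) \<le> e"
        using eventually_ge_at_top[of N]
      proof eventually_elim
        case (elim m)
        have "(\<Sum>p\<in>F. w p * norm ((X n - X m) p)) \<le> wl1_norm w (X n - X m)"
          by (rule finite_sum_le_has_sum[OF wl1_has_sum[OF wl1_diff[OF X X]] F])
            (simp_all add: weight_nonneg)
        also have "\<dots> \<le> e" using N n elim by (simp add: less_imp_le)
        finally show ?case by simp
      qed
    qed simp
    thus ?thesis using wl1_norm_le[of "X _ - L" e] by blast
  qed
  have "L \<in> wl1 w"
  proof -
    obtain N where "X N - L \<in> wl1 w" using close[of 1] by auto
    from wl1_diff[OF X[of N] this] show ?thesis by (simp add: algebra_simps)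
  qed
  moreover have "(\<lambda>n. wl1_norm w (X n - L)) \<longlonglongrightarrow> 0"
  proof (rule LIMSEQ_I)
    fix e :: real assume "0 < e"
    then obtain N where N: "\<forall>n\<ge>N. wl1_norm w (X n - L) \<le> e / 2"
      using close[of "e / 2"] by auto
    have "norm (wl1_norm w (X n - L) - 0) < e" if "n \<ge> N" for n
      using N that \<open>0 < e\<close> wl1_norm_nonneg[of "X n - L"] by (fastforce simp: abs_of_nonneg)
    thus "\<exists>N. \<forall>n\<ge>N. norm (wl1_norm w (X n - L) - 0) < e" by blast
  qed
  ultimately show ?thesis by blast
qed

text \<open>
  Summing first over \<open>k\<close>, the weighted triple series of \<open>\<bar>u p\<bar> \<bar>v q\<bar> \<bar>K p q k\<bar>\<close> is dominated by
  the double series of \<open>(w p \<bar>u p\<bar>) (w q \<bar>v q\<bar>)\<close>, whose value is the product of the norms;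
  Tonelli permits the opposite order of summation, which gives the norm of the product.
\<close>
lemma wl1_bilinear_ext:
  assumes K: "\<And>p q. K p q \<in> wl1 w" "\<And>p q. wl1_norm w (K p q) \<le> w p * w q"
    and u: "u \<in> wl1 w" and v: "v \<in> wl1 w"
  shows "(\<lambda>(p, q). u p * v q * K p q k) summable_on UNIV"
    and "bilinear_ext K u v \<in> wl1 w"
    and "wl1_norm w (bilinear_ext K u v) \<le> wl1_norm w u * wl1_norm w v"
proof -
  define f where "f = (\<lambda>(p, q) k. norm (u p) * norm (v q) * (w k * norm (K p q k)))"
  define g where "g = (\<lambda>(p, q). norm (u p) * norm (v q) * wl1_norm w (K p q))"
  define h where "h = (\<lambda>(p, q). (w p * norm (u p)) * (w q * norm (v q)))"
  have h: "(h has_sum wl1_norm w u * wl1_norm w v) UNIV"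
    unfolding h_def by (intro has_sum_product_nonneg wl1_has_sum u v) (simp_all add: weight_nonneg)
  have gh: "g x \<le> h x" for x
  proof (cases x)
    case (Pair p q)
    have "norm (u p) * norm (v q) * wl1_norm w (K p q) \<le> norm (u p) * norm (v q) * (w p * w q)"
      by (intro mult_left_mono K) simp
    thus ?thesis by (simp add: Pair g_def h_def mult_ac)
  qed
  have f_nonneg: "0 \<le> f x k" for x k
    by (simp add: f_def weight_nonneg split: prod.split)
  have fg: "(f x has_sum g x) UNIV" for x
    unfolding f_def g_def by (cases x) (auto intro!: has_sum_cmult_right wl1_has_sum K)
  have g: "g summable_on UNIV"
    by (rule summable_on_comparison_test[OF has_sum_imp_summable[OF h] gh])
      (auto simp: g_def wl1_norm_nonneg)
  have g_le: "(\<Sum>\<^sub>\<infinity>x. g x) \<le> wl1_norm w u * wl1_norm w v"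
    using has_sum_mono[OF has_sum_infsum[OF g] h] gh by blast
  note fubini = nonneg_Fubini[OF f_nonneg fg g]
  have f_eq: "f x k = w k * norm (case x of (p, q) \<Rightarrow> u p * v q * K p q k)" for x k
    by (simp add: f_def norm_mult split: prod.split)
  have norm_summ: "(\<lambda>x. norm (case x of (p, q) \<Rightarrow> u p * v q * K p q k)) summable_on UNIV" for k
    using summable_on_cmult_right[OF fubini(2)[of k], of "inverse (w k)"] weight_pos[of k]
    by (simp add: f_eq mult.assoc[symmetric])
  thus "(\<lambda>(p, q). u p * v q * K p q k) summable_on UNIV"
    by (rule abs_summable_summable)
  have le: "w k * norm (bilinear_ext K u v k) \<le> (\<Sum>\<^sub>\<infinity>x. f x k)" for k
  proof -
    have "norm (bilinear_ext K u v k) \<le> (\<Sum>\<^sub>\<infinity>x. norm (case x of (p, q) \<Rightarrow> u p * v q * K p q k))"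
      unfolding bilinear_ext_def by (rule norm_infsum_bound[OF norm_summ])
    hence "w k * norm (bilinear_ext K u v k) \<le> w k * (\<Sum>\<^sub>\<infinity>x. norm (case x of (p, q) \<Rightarrow> u p * v q * K p q k))"
      by (intro mult_left_mono weight_nonneg)
    thus ?thesis
      by (simp add: f_eq infsum_cmult_right')
  qed
  have summ: "(\<lambda>k. w k * norm (bilinear_ext K u v k)) summable_on UNIV"
    by (rule summable_on_comparison_test[OF has_sum_imp_summable[OF fubini(3)] le])
      (simp add: weight_nonneg)
  thus "bilinear_ext K u v \<in> wl1 w"
    by (simp add: wl1_def)
  have "wl1_norm w (bilinear_ext K u v) \<le> (\<Sum>\<^sub>\<infinity>x. g x)"
    unfolding wl1_norm_def using has_sum_mono[OF has_sum_infsum[OF summ] fubini(3)] le by blast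
  thus "wl1_norm w (bilinear_ext K u v) \<le> wl1_norm w u * wl1_norm w v"
    using g_le by simp
qed

end


section \<open>Coordinates for CQT matrices\<close>

type_synonym cqt_index = "int + nat \<times> nat"

definition cqt_matrix :: "(cqt_index \<Rightarrow> complex) \<Rightarrow> infmat" where
  "cqt_matrix u = (\<lambda>i j. u (Inl (int j - int i)) + u (Inr (i, j)))"

definition cqt_weight :: "cqt_index \<Rightarrow> real" where
  "cqt_weight p = (case p of Inl r \<Rightarrow> 1 + \<bar>real_of_int r\<bar> | Inr _ \<Rightarrow> 1)"

lemma cqt_weight_simps [simp]:
  "cqt_weight (Inl r) = 1 + \<bar>real_of_int r\<bar>" "cqt_weight (Inr e) = 1"
  by (simp_all add: cqt_weight_def)

lemma cqt_weight_ge_1: "1 \<le> cqt_weight p"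
  by (cases p) auto

interpretation cqt_l1: l1_weight cqt_weight
  by unfold_locales (rule cqt_weight_ge_1)


section \<open>Structure constants of the matrix product\<close>

text \<open>
  The basis matrix number \<open>p\<close>, that is, \<open>cqt_matrix\<close> of the family with a single \<open>1\<close> at \<open>p\<close>.
\<close>
definition basis_entry :: "cqt_index \<Rightarrow> nat \<Rightarrow> nat \<Rightarrow> complex" where
  "basis_entry p i j = (case p of
      Inl r \<Rightarrow> of_bool (int j - int i = r)
    | Inr (k, l) \<Rightarrow> of_bool (i = k \<and> j = l))"

text \<open>
  The second equation is the correction that makes \<open>T\<^sub>r T\<^sub>s\<close> differ from \<open>T\<^bsub>r+s\<^esub>\<close>: the path from
  row \<open>i\<close> to column \<open>j = i + r + s\<close> passes through the index \<open>i + r\<close>, and contributes to the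
  product of the semi-infinite matrices only if that index is nonnegative. Weighted by the Fourier
  coefficients of two symbols and summed over \<open>r\<close> and \<open>s\<close>, these corrections form the negative of
  a product of two Hankel matrices. The last equation holds because the matrix units span an ideal.
\<close>
fun structure_const :: "cqt_index \<Rightarrow> cqt_index \<Rightarrow> cqt_index \<Rightarrow> complex" where
  "structure_const (Inl r) (Inl s) (Inl t) = of_bool (t = r + s)"
| "structure_const (Inl r) (Inl s) (Inr (i, j)) = - of_bool (int j - int i = r + s \<and> int i + r < 0)"
| "structure_const (Inl r) (Inr (k, l)) (Inr (i, j)) = of_bool (int k - int i = r \<and> j = l)"
| "structure_const (Inr (k, l)) (Inl s) (Inr (i, j)) = of_bool (i = k \<and> int j - int l = s)"
| "structure_const (Inr (k, l)) (Inr (k', l')) (Inr (i, j)) = of_bool (l = k' \<and> i = k \<and> j = l')"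
| "structure_const _ _ (Inl _) = 0"

lemma basis_entry_row:
  "\<exists>l. \<forall>l'. l' \<noteq> l \<longrightarrow> basis_entry p i l' = 0"
proof (cases p)
  case (Inl r)
  thus ?thesis
    by (intro exI[of _ "nat (int i + r)"]) (auto simp: basis_entry_def)
next
  case (Inr e)
  thus ?thesis
    by (intro exI[of _ "snd e"]) (auto simp: basis_entry_def split: prod.split)
qed

lemma norm_basis_entry_le: "norm (basis_entry p i j) \<le> 1"
  by (auto simp: basis_entry_def split: sum.split prod.split)

text \<open>
  A row of a basis matrix has at most one nonzero entry, so the product has at most one nonzero
  term. Only the two coordinates in the statement affect the entry \<open>(i, j)\<close> of a matrix.
\<close>
lemma basis_entry_product:
  "((\<lambda>l. basis_entry p i l * basis_entry q l j) has_sum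
      (structure_const p q (Inl (int j - int i)) + structure_const p q (Inr (i, j)))) UNIV"
proof (cases p)
  case p: (Inl r)
  show ?thesis
  proof (rule has_sum_finite_neutralI[where B = "{l. int l = int i + r}"])
    show fin: "finite {l. int l = int i + r}"
      by (rule finite_subset[of _ "{nat (int i + r)}"]) auto
    have "{l. int l = int i + r} = (if 0 \<le> int i + r then {nat (int i + r)} else {})"
      by auto
    thus "structure_const p q (Inl (int j - int i)) + structure_const p q (Inr (i, j)) =
        (\<Sum>l\<in>{l. int l = int i + r}. basis_entry p i l * basis_entry q l j)"
      by (cases q) (auto simp: p basis_entry_def)
  qed (auto simp: p basis_entry_def)
next
  case p: (Inr e)
  obtain k m where e: "e = (k, m)" by (cases e)
  show ?thesis
    by (rule has_sum_finite_neutralI[where B = "{m}"]; cases q) (auto simp: p e basis_entry_def)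
qed

lemma summable_norm_basis_entry_product:
  "(\<lambda>l. norm (basis_entry p i l * basis_entry q l j)) summable_on UNIV"
  "(\<Sum>\<^sub>\<infinity>l. norm (basis_entry p i l * basis_entry q l j)) \<le> 1"
proof -
  obtain l where l: "\<And>l'. l' \<noteq> l \<Longrightarrow> basis_entry p i l' = 0"
    using basis_entry_row by blast
  have "((\<lambda>l. norm (basis_entry p i l * basis_entry q l j)) has_sum norm (basis_entry p i l * basis_entry q l j)) UNIV"
    by (rule has_sum_finite_neutralI[where B = "{l}"]) (use l in auto)
  moreover have "norm (basis_entry p i l * basis_entry q l j) \<le> 1"
    unfolding norm_mult by (intro mult_le_one norm_basis_entry_le norm_ge_zero)
  ultimately show "(\<lambda>l. norm (basis_entry p i l * basis_entry q l j)) summable_on UNIV"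
    "(\<Sum>\<^sub>\<infinity>l. norm (basis_entry p i l * basis_entry q l j)) \<le> 1"
    by (simp_all add: has_sum_iff)
qed

text \<open>
  A correction at \<open>(i, j)\<close> requires \<open>i < -r\<close> and \<open>0 \<le> j = (i + r) + s < s\<close>. Hence there is none
  if \<open>s \<le> 0\<close>, and if \<open>s \<ge> 1\<close> their number is at most \<open>nat (-r)\<close>, the number of rows \<open>i\<close>; in both
  cases it is at most \<open>\<bar>r\<bar> \<bar>s\<bar>\<close>. This is where the weight \<open>1 + \<bar>i\<bar>\<close>, and thus the derivative in
  the norm, is essential: the number of corrections is not bounded uniformly in \<open>r\<close> and \<open>s\<close>.
\<close>
lemma structure_const_shifts_support:
  fixes r s :: int
  defines "H \<equiv> if 0 < s then (\<lambda>i. Inr (i, nat (int i + r + s))) ` {..<nat (- r)} else ({} :: cqt_index set)"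
  shows "finite H" "k \<notin> insert (Inl (r + s)) H \<Longrightarrow> structure_const (Inl r) (Inl s) k = 0"
    and "(\<Sum>k\<in>insert (Inl (r + s)) H. cqt_weight k) \<le> cqt_weight (Inl r) * cqt_weight (Inl s)"
proof -
  show fin: "finite H" by (simp add: H_def)
  have "card H \<le> nat (- r) * nat s"
  proof (cases "0 < s")
    case True
    hence "card H \<le> nat (- r)"
      using card_image_le[of "{..<nat (- r)}"] by (simp add: H_def)
    also have "\<dots> * 1 \<le> nat (- r) * nat s"
      using True by (intro mult_left_mono) auto
    finally show ?thesis by simp
  qed (simp add: H_def)
  also have "\<dots> \<le> nat \<bar>r\<bar> * nat \<bar>s\<bar>"
    by (intro mult_mono) auto
  finally have "real (card H) \<le> real (nat \<bar>r\<bar> * nat \<bar>s\<bar>)"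
    by (rule of_nat_mono)
  hence card_H: "real (card H) \<le> \<bar>real_of_int r\<bar> * \<bar>real_of_int s\<bar>"
    by simp
  have "(\<Sum>k\<in>H. cqt_weight k) = (\<Sum>k\<in>H. 1)"
    by (intro sum.cong) (auto simp: H_def split: if_splits)
  moreover have "Inl (r + s) \<notin> H"
    by (auto simp: H_def)
  ultimately have "(\<Sum>k\<in>insert (Inl (r + s)) H. cqt_weight k) = 1 + \<bar>real_of_int r + real_of_int s\<bar> + card H"
    using fin by simp
  thus "(\<Sum>k\<in>insert (Inl (r + s)) H. cqt_weight k) \<le> cqt_weight (Inl r) * cqt_weight (Inl s)"
    using card_H abs_triangle_ineq[of "real_of_int r" "real_of_int s"] by (simp add: algebra_simps)
  show "structure_const (Inl r) (Inl s) k = 0" if k: "k \<notin> insert (Inl (r + s)) H"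
  proof (cases k)
    case (Inl t)
    thus ?thesis using k by simp
  next
    case (Inr e)
    then obtain i j where k_eq: "k = Inr (i, j)" by (cases e) auto
    have "k \<in> H" if ij: "int j - int i = r + s" "int i + r < 0"
    proof -
      have "0 < s" "i < nat (- r)" "j = nat (int i + r + s)"
        using ij by auto
      thus ?thesis by (auto simp: H_def k_eq)
    qed
    thus ?thesis using k by (auto simp: k_eq)
  qed
qed

lemma structure_const_support:
  "\<exists>S. finite S \<and> (\<forall>k. k \<notin> S \<longrightarrow> structure_const p q k = 0) \<and>
     (\<Sum>k\<in>S. cqt_weight k) \<le> cqt_weight p * cqt_weight q"
proof (cases "\<exists>r s. p = Inl r \<and> q = Inl s")
  case True
  then obtain r s where pq: "p = Inl r" "q = Inl s" by blast
  show ?thesis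
    unfolding pq using structure_const_shifts_support[where r = r and s = s] by (meson finite_insert)
next
  case False
  \<comment> \<open>The product of the two basis matrices is a matrix unit or zero, and \<open>e\<close> is the only possible
    position of its entry. When a shift leads to a negative index the product is zero,
    so that the position picked by the truncation \<open>nat\<close> is as good as any other.\<close>
  define e where "e = (case (p, q) of
      (Inl r, Inr (k, l)) \<Rightarrow> (nat (int k - r), l)
    | (Inr (k, l), Inl s) \<Rightarrow> (k, nat (int l + s))
    | (Inr (k, l), Inr (k', l')) \<Rightarrow> (k, l')
    | _ \<Rightarrow> (0, 0))"
  have "structure_const p q k = 0" if "k \<noteq> Inr e" for k
    using False that by (cases "(p, q, k)" rule: structure_const.cases) (auto simp: e_def)
  moreover have "1 * 1 \<le> cqt_weight p * cqt_weight q"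
    by (intro mult_mono cqt_weight_ge_1 order_trans[OF _ cqt_weight_ge_1]) auto
  ultimately show ?thesis
    by (intro exI[of _ "{Inr e}"]) auto
qed

lemma structure_const_wl1:
  "structure_const p q \<in> wl1 cqt_weight"
  "wl1_norm cqt_weight (structure_const p q) \<le> cqt_weight p * cqt_weight q"
proof -
  obtain S where S: "finite S" "\<And>k. k \<notin> S \<Longrightarrow> structure_const p q k = 0"
    "(\<Sum>k\<in>S. cqt_weight k) \<le> cqt_weight p * cqt_weight q"
    using structure_const_support by blast
  have norm_le_1: "norm (structure_const p q k) \<le> 1" for k
    by (induction p q k rule: structure_const.induct) auto
  have "((\<lambda>k. cqt_weight k * norm (structure_const p q k)) has_sum
          (\<Sum>k\<in>S. cqt_weight k * norm (structure_const p q k))) UNIV"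
    by (rule has_sum_finite_neutralI[OF S(1)]) (use S(2) in auto)
  moreover have "(\<Sum>k\<in>S. cqt_weight k * norm (structure_const p q k)) \<le> (\<Sum>k\<in>S. cqt_weight k * 1)"
    by (intro sum_mono mult_left_mono norm_le_1 order_trans[OF _ cqt_weight_ge_1]) simp
  ultimately show "structure_const p q \<in> wl1 cqt_weight"
    "wl1_norm cqt_weight (structure_const p q) \<le> cqt_weight p * cqt_weight q"
    using S(3) by (simp_all add: wl1_def wl1_norm_def has_sum_iff)
qed


section \<open>The product of two CQT matrices\<close>

lemma cqt_matrix_expansion:
  "((\<lambda>p. u p * basis_entry p i j) has_sum cqt_matrix u i j) UNIV"
proof (rule has_sum_finite_neutralI[where B = "{Inl (int j - int i), Inr (i, j)}"])
  show "u p * basis_entry p i j = 0" if "p \<in> UNIV - {Inl (int j - int i), Inr (i, j)}" for p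
    using that by (cases p) (auto simp: basis_entry_def)
qed (auto simp: basis_entry_def cqt_matrix_def)

definition cqt_conv :: "(cqt_index \<Rightarrow> complex) \<Rightarrow> (cqt_index \<Rightarrow> complex) \<Rightarrow> cqt_index \<Rightarrow> complex" where
  "cqt_conv = bilinear_ext structure_const"

lemma cqt_conv:
  assumes "u \<in> wl1 cqt_weight" "v \<in> wl1 cqt_weight"
  shows "cqt_conv u v \<in> wl1 cqt_weight"
    and "wl1_norm cqt_weight (cqt_conv u v) \<le> wl1_norm cqt_weight u * wl1_norm cqt_weight v"
  unfolding cqt_conv_def
  using cqt_l1.wl1_bilinear_ext(2,3)[OF structure_const_wl1 assms]
  by blast+

text \<open>
  Both sides are the sum of the absolutely convergent series of
  \<open>u p * v q * basis_entry p i l * basis_entry q l j\<close> over all \<open>p\<close>, \<open>q\<close> and \<open>l\<close>. Summing over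
  \<open>p\<close> and \<open>q\<close> first produces the terms of the matrix product, summing over \<open>l\<close> first produces the
  structure constants.
\<close>
lemma cqt_matrix_product_has_sum:
  assumes u: "u \<in> wl1 cqt_weight" and v: "v \<in> wl1 cqt_weight"
  shows "((\<lambda>l. cqt_matrix u i l * cqt_matrix v l j) has_sum cqt_matrix (cqt_conv u v) i j) UNIV"
proof -
  define f where "f = (\<lambda>(p, q) l. u p * v q * (basis_entry p i l * basis_entry q l j))"
  define g where "g = (\<lambda>(p, q). norm (u p) * norm (v q) * (\<Sum>\<^sub>\<infinity>l. norm (basis_entry p i l * basis_entry q l j)))"
  define h where "h = (\<lambda>(p, q). norm (u p) * norm (v q))"
  have abs_uv: "(\<lambda>p. norm (u p)) summable_on UNIV" "(\<lambda>p. norm (v p)) summable_on UNIV"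
    using cqt_l1.wl1_abs_summable u v by blast+
  have h: "h summable_on UNIV"
    unfolding h_def
    using has_sum_product_nonneg[OF has_sum_infsum[OF abs_uv(1)] _ has_sum_infsum[OF abs_uv(2)]]
    by (auto intro: has_sum_imp_summable)
  have g: "g summable_on UNIV"
  proof (rule summable_on_comparison_test[OF h])
    show "g x \<le> h x" for x
      using summable_norm_basis_entry_product(2)
      by (auto simp: g_def h_def mult_left_le split: prod.split)
    show "0 \<le> g x" for x
      by (auto simp: g_def intro!: mult_nonneg_nonneg infsum_nonneg split: prod.split)
  qed
  have inner: "((\<lambda>l. norm (f x l)) has_sum g x) UNIV" for x
    unfolding f_def g_def
    using has_sum_cmult_right[OF has_sum_infsum[OF summable_norm_basis_entry_product(1)]]
    by (cases x) (simp add: norm_mult)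
  have "(\<lambda>(x, l). norm (f x l)) summable_on UNIV"
    by (rule nonneg_Fubini(1)[OF _ inner g]) simp
  hence "(\<lambda>xl. norm (case xl of (x, l) \<Rightarrow> f x l)) summable_on UNIV"
    by (simp add: case_prod_unfold)
  hence f_summ: "(\<lambda>(x, l). f x l) summable_on UNIV \<times> UNIV"
    using abs_summable_summable by simp
  then obtain T where T: "((\<lambda>(x, l). f x l) has_sum T) (UNIV \<times> UNIV)"
    by (auto simp: summable_on_def)
  hence T': "((\<lambda>(l, x). f x l) has_sum T) (UNIV \<times> UNIV)"
    by (subst (asm) has_sum_swap) simp
  have slice: "(\<lambda>x. f x l) summable_on UNIV" for l
    using summable_on_SigmaD1[OF has_sum_imp_summable[OF T'], of l] by simp
  have entry: "((\<lambda>x. f x l) has_sum cqt_matrix u i l * cqt_matrix v l j) UNIV" for l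
  proof -
    have "((\<lambda>(p, q). (u p * basis_entry p i l) * (v q * basis_entry q l j)) has_sum
            cqt_matrix u i l * cqt_matrix v l j) (UNIV \<times> UNIV)"
    proof (rule has_sum_SigmaI)
      show "((\<lambda>q. case (p, q) of (p, q) \<Rightarrow> (u p * basis_entry p i l) * (v q * basis_entry q l j)) has_sum
              (u p * basis_entry p i l) * cqt_matrix v l j) UNIV" for p
        using has_sum_cmult_right[OF cqt_matrix_expansion] by simp
      show "((\<lambda>p. (u p * basis_entry p i l) * cqt_matrix v l j) has_sum cqt_matrix u i l * cqt_matrix v l j) UNIV"
        by (intro has_sum_cmult_left cqt_matrix_expansion)
      show "(\<lambda>(p, q). (u p * basis_entry p i l) * (v q * basis_entry q l j)) summable_on UNIV \<times> UNIV"
        using slice[of l] by (simp add: f_def case_prod_unfold mult_ac)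
    qed
    thus ?thesis by (simp add: f_def case_prod_unfold mult_ac)
  qed
  have "((\<lambda>l. cqt_matrix u i l * cqt_matrix v l j) has_sum T) UNIV"
    by (rule has_sum_SigmaD[OF T']) (use entry in simp)
  moreover have "cqt_matrix (cqt_conv u v) i j = T"
  proof -
    define K where "K = (\<lambda>k (p, q). u p * v q * structure_const p q k)"
    have K: "(K k has_sum cqt_conv u v k) UNIV" for k
      using cqt_l1.wl1_bilinear_ext(1)[OF structure_const_wl1 u v]
      by (simp add: cqt_conv_def bilinear_ext_def K_def)
    have "((\<lambda>x. K (Inl (int j - int i)) x + K (Inr (i, j)) x) has_sum cqt_matrix (cqt_conv u v) i j) UNIV"
      unfolding cqt_matrix_def by (intro has_sum_add K)
    moreover have "((\<lambda>x. K (Inl (int j - int i)) x + K (Inr (i, j)) x) has_sum T) UNIV"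
    proof (rule has_sum_SigmaD[OF T])
      fix x :: "cqt_index \<times> cqt_index"
      obtain p q where x: "x = (p, q)" by (cases x)
      show "((\<lambda>l. case (x, l) of (x, l) \<Rightarrow> f x l) has_sum K (Inl (int j - int i)) x + K (Inr (i, j)) x) UNIV"
        using has_sum_cmult_right[OF basis_entry_product[of p i q j], of "u p * v q"]
        by (simp add: x f_def K_def distrib_left)
    qed
    ultimately show ?thesis by (rule has_sum_unique)
  qed
  ultimately show ?thesis by simp
qed


section \<open>Uniqueness of the coordinates\<close>

text \<open>
  If the matrix vanishes, then along each diagonal the correction is constant, being the negative
  of the Toeplitz coefficient. A diagonal is infinite and the correction summable, so the constant
  is \<open>0\<close>.
\<close>
lemma cqt_matrix_eq_0:
  assumes u: "u \<in> wl1 cqt_weight" and zero: "cqt_matrix u = 0"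
  shows "u = 0"
proof -
  have uInr: "u (Inr (i, j)) = - u (Inl (int j - int i))" for i j
    using fun_cong[OF fun_cong[OF zero, of i], of j] by (simp add: cqt_matrix_def add_eq_0_iff)
  have uInl: "u (Inl r) = 0" for r
  proof (rule ccontr)
    assume nz: "u (Inl r) \<noteq> 0"
    \<comment> \<open>All positions on the diagonal number \<open>r\<close>, listed from the border of the matrix.\<close>
    define h :: "nat \<Rightarrow> cqt_index" where "h n = Inr (n + nat (- r), n + nat r)" for n
    have "(\<lambda>p. norm (u p)) summable_on range h"
      using cqt_l1.wl1_abs_summable[OF u] summable_on_subset_UNIV by blast
    moreover have "inj h" by (auto simp: h_def inj_def)
    ultimately have "((\<lambda>p. norm (u p)) \<circ> h) summable_on UNIV"
      using summable_on_reindex by blast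
    moreover have "(\<lambda>p. norm (u p)) \<circ> h = (\<lambda>_. norm (u (Inl r)))"
      by (auto simp: h_def uInr fun_eq_iff)
    ultimately show False
      using infsum_diverge_constant[of "UNIV :: nat set" "norm (u (Inl r))"] nz by simp
  qed
  show ?thesis
  proof
    show "u p = 0 p" for p
      by (cases p) (auto simp: uInl uInr)
  qed
qed

lemma cqt_matrix_add: "cqt_matrix (u + v) = cqt_matrix u + cqt_matrix v"
  by (auto simp: cqt_matrix_def fun_eq_iff)

lemma cqt_matrix_diff: "cqt_matrix (u - v) = cqt_matrix u - cqt_matrix v"
  by (auto simp: cqt_matrix_def fun_eq_iff)

lemma cqt_matrix_scale: "cqt_matrix (\<lambda>p. c * u p) = mat_scale c (cqt_matrix u)"
  by (auto simp: cqt_matrix_def mat_scale_def fun_eq_iff distrib_left)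

lemma cqt_matrix_0: "cqt_matrix 0 = 0"
  by (auto simp: cqt_matrix_def fun_eq_iff)

lemma inj_on_cqt_matrix: "inj_on cqt_matrix (wl1 cqt_weight)"
proof (rule inj_onI)
  fix u v assume u: "u \<in> wl1 cqt_weight" and v: "v \<in> wl1 cqt_weight" and eq: "cqt_matrix u = cqt_matrix v"
  have "u - v = 0"
    by (rule cqt_matrix_eq_0) (use cqt_l1.wl1_diff[OF u v] eq in \<open>simp_all add: cqt_matrix_diff\<close>)
  thus "u = v" by simp
qed


section \<open>Coordinates of Toeplitz plus correction\<close>

lemma has_sum_UNIV_sum:
  fixes f :: "'a + 'b \<Rightarrow> 'c :: {topological_comm_monoid_add}"
  assumes "((\<lambda>x. f (Inl x)) has_sum a) UNIV" "((\<lambda>y. f (Inr y)) has_sum b) UNIV"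
  shows "(f has_sum (a + b)) UNIV"
proof -
  have "(f has_sum a) (range Inl)" "(f has_sum b) (range Inr)"
    using assms by (simp_all add: has_sum_reindex o_def)
  hence "(f has_sum (a + b)) (range Inl \<union> range Inr)"
    by (intro has_sum_Un_disjoint) auto
  thus ?thesis by (simp add: UNIV_sum)
qed

lemma summable_on_UNIV_sumD:
  fixes f :: "'a + 'b \<Rightarrow> 'c :: banach"
  assumes "f summable_on UNIV"
  shows "(\<lambda>x. f (Inl x)) summable_on UNIV" "(\<lambda>y. f (Inr y)) summable_on UNIV"
  using summable_on_reindex[of Inl UNIV f] summable_on_reindex[of Inr UNIV f]
    summable_on_subset_UNIV[OF assms] by (simp_all add: o_def)

lemma toeplitz_plus_fin_eq_cqt_matrix:
  assumes a: "a \<in> wiener1" and E: "E \<in> fin_mats"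
  defines "u \<equiv> case_sum (wiener_coeff a) (\<lambda>(i, j). E i j)"
  shows "u \<in> wl1 cqt_weight" "toeplitz a + E = cqt_matrix u"
    "wl1_norm cqt_weight u = wiener1_norm a + fin_norm E"
proof -
  have "((\<lambda>p. cqt_weight p * norm (u p)) has_sum (wiener1_norm a + fin_norm E)) UNIV"
  proof (rule has_sum_UNIV_sum)
    show "((\<lambda>r. cqt_weight (Inl r) * norm (u (Inl r))) has_sum wiener1_norm a) UNIV"
      using wiener1_coeff[OF a] by (simp add: u_def has_sum_iff)
    have "((\<lambda>(i, j). norm (E i j)) has_sum fin_norm E) UNIV"
      using E by (simp add: fin_mats_def fin_norm_def)
    thus "((\<lambda>e. cqt_weight (Inr e) * norm (u (Inr e))) has_sum fin_norm E) UNIV"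
      by (simp add: u_def case_prod_unfold)
  qed
  thus "u \<in> wl1 cqt_weight" "wl1_norm cqt_weight u = wiener1_norm a + fin_norm E"
    by (auto simp: wl1_def wl1_norm_def has_sum_iff)
  show "toeplitz a + E = cqt_matrix u"
    by (auto simp: toeplitz_def cqt_matrix_def u_def fun_eq_iff)
qed

lemma cqt_matrix_eq_toeplitz_plus_fin:
  assumes u: "u \<in> wl1 cqt_weight"
  shows "\<exists>a\<in>wiener1. \<exists>E\<in>fin_mats. cqt_matrix u = toeplitz a + E"
proof -
  have "(\<lambda>p. cqt_weight p * norm (u p)) summable_on UNIV"
    using u by (simp add: wl1_def)
  note summ = summable_on_UNIV_sumD[OF this]
  define a where "a = symbol (\<lambda>r. u (Inl r))"
  define E where "E = (\<lambda>i j. u (Inr (i, j)))"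
  have "(\<lambda>r. (1 + \<bar>real_of_int r\<bar>) * norm (u (Inl r))) summable_on UNIV"
    using summ(1) by simp
  note c = this int_weight_abs_summable(1)[OF this]
  have a: "a \<in> wiener1" unfolding a_def by (rule symbol_in_wiener1[OF c(1)])
  moreover have E: "E \<in> fin_mats"
    using summ(2) by (simp add: fin_mats_def E_def case_prod_unfold)
  moreover have "cqt_matrix u = toeplitz a + E"
    using wiener_coeff_eqI[OF wiener_expansion_symbol[OF c(2)]]
    by (auto simp: cqt_matrix_def toeplitz_def a_def E_def fun_eq_iff)
  ultimately show ?thesis by blast
qed

lemma CQT_eq: "CQT = cqt_matrix ` wl1 cqt_weight"
proof
  show "CQT \<subseteq> cqt_matrix ` wl1 cqt_weight"
    unfolding CQT_def using toeplitz_plus_fin_eq_cqt_matrix(1,2) by blast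
  show "cqt_matrix ` wl1 cqt_weight \<subseteq> CQT"
    unfolding CQT_def using cqt_matrix_eq_toeplitz_plus_fin by blast
qed

text \<open>
  The coordinates depend only on the matrix, so every decomposition of the matrix
  gives the same value and the description in \<open>cqt_norm\<close> is proper.
\<close>
lemma cqt_norm_cqt_matrix:
  assumes u: "u \<in> wl1 cqt_weight"
  shows "cqt_norm (cqt_matrix u) = wl1_norm cqt_weight u"
proof -
  have norm_eq: "wiener1_norm a + fin_norm E = wl1_norm cqt_weight u"
    if "a \<in> wiener1" "E \<in> fin_mats" "cqt_matrix u = toeplitz a + E" for a E
    using toeplitz_plus_fin_eq_cqt_matrix[OF that(1,2)] that(3) inj_onD[OF inj_on_cqt_matrix] u by metis
  obtain a E where aE: "a \<in> wiener1" "E \<in> fin_mats" "cqt_matrix u = toeplitz a + E"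
    using cqt_matrix_eq_toeplitz_plus_fin[OF u] by blast
  show ?thesis
    unfolding cqt_norm_def
  proof (rule the_equality)
    show "\<exists>a\<in>wiener1. \<exists>E\<in>fin_mats. cqt_matrix u = toeplitz a + E \<and>
        wl1_norm cqt_weight u = wiener1_norm a + fin_norm E"
      using aE norm_eq[OF aE] by (intro bexI[of _ a] bexI[of _ E]) auto
  qed (use norm_eq in auto)
qed


section \<open>The Banach algebra\<close>

lemma mat_mult_cqt_matrix:
  assumes "u \<in> wl1 cqt_weight" "v \<in> wl1 cqt_weight"
  shows "mat_mult (cqt_matrix u) (cqt_matrix v) = cqt_matrix (cqt_conv u v)"
    and "mat_mult_defined (cqt_matrix u) (cqt_matrix v)"
  using cqt_matrix_product_has_sum[OF assms]
  by (auto simp: mat_mult_def mat_mult_defined_def fun_eq_iff has_sum_iff)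

lemma CQT_cases:
  assumes "A \<in> CQT"
  obtains u where "u \<in> wl1 cqt_weight" "A = cqt_matrix u" "cqt_norm A = wl1_norm cqt_weight u"
  using assms cqt_norm_cqt_matrix by (auto simp: CQT_eq)

text \<open>
  A row or a column meets every diagonal at most once, so its coordinates are two injectively
  indexed parts of the summable family \<open>u\<close>.
\<close>
lemma CQT_abs_summable:
  assumes "A \<in> CQT"
  shows row_abs_summable: "(\<lambda>k. norm (A i k)) summable_on UNIV"
    and column_abs_summable: "(\<lambda>k. norm (A k j)) summable_on UNIV"
    and entry_bound: "\<exists>C. \<forall>i j. norm (A i j) \<le> C"
proof -
  obtain u where u: "u \<in> wl1 cqt_weight" and A: "A = cqt_matrix u"
    using assms by (rule CQT_cases)
  note summ = cqt_l1.wl1_abs_summable[OF u]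
  have inj_summ: "(\<lambda>k. norm (u (h k))) summable_on UNIV" if "inj h" for h :: "nat \<Rightarrow> cqt_index"
    using summable_on_reindex[OF that, of "\<lambda>p. norm (u p)"] summable_on_subset_UNIV[OF summ] by (simp add: o_def)
  show "(\<lambda>k. norm (A i k)) summable_on UNIV"
  proof (rule summable_on_comparison_test)
    show "(\<lambda>k. norm (u (Inl (int k - int i))) + norm (u (Inr (i, k)))) summable_on UNIV"
      by (intro summable_on_add inj_summ) (auto simp: inj_def)
  qed (auto simp: A cqt_matrix_def norm_triangle_ineq)
  show "(\<lambda>k. norm (A k j)) summable_on UNIV"
  proof (rule summable_on_comparison_test)
    show "(\<lambda>k. norm (u (Inl (int j - int k))) + norm (u (Inr (k, j)))) summable_on UNIV"
      by (intro summable_on_add inj_summ) (auto simp: inj_def)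
  qed (auto simp: A cqt_matrix_def norm_triangle_ineq)
  have "norm (A i j) \<le> 2 * wl1_norm cqt_weight u" for i j
    using norm_triangle_ineq[of "u (Inl (int j - int i))" "u (Inr (i, j))"]
      cqt_l1.wl1_norm_coord_le[OF u, of "Inl (int j - int i)"]
      cqt_l1.wl1_norm_coord_le[OF u, of "Inr (i, j)"]
    by (simp add: A cqt_matrix_def)
  thus "\<exists>C. \<forall>i j. norm (A i j) \<le> C" by blast
qed

text \<open>
  The double series of \<open>A i k * B k l * C l j\<close> converges absolutely, because row \<open>i\<close> of \<open>A\<close> and
  column \<open>j\<close> of \<open>C\<close> are summable and the entries of \<open>B\<close> are bounded.
\<close>
lemma mat_mult_assoc_CQT:
  assumes A: "A \<in> CQT" and B: "B \<in> CQT" and C: "C \<in> CQT"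
  shows "mat_mult (mat_mult A B) C = mat_mult A (mat_mult B C)"
proof (intro ext)
  fix i j
  obtain b where b: "\<And>k l. norm (B k l) \<le> b"
    using entry_bound[OF B] by blast
  have "(\<lambda>(k, l). norm (A i k) * norm (C l j)) summable_on UNIV"
    using has_sum_product_nonneg[OF has_sum_infsum[OF row_abs_summable[OF A]] _
        has_sum_infsum[OF column_abs_summable[OF C]]]
    by (auto intro: has_sum_imp_summable)
  hence "(\<lambda>x. b * (case x of (k, l) \<Rightarrow> norm (A i k) * norm (C l j))) summable_on UNIV"
    by (rule summable_on_cmult_right)
  hence "(\<lambda>x. norm (case x of (k, l) \<Rightarrow> A i k * B k l * C l j)) summable_on UNIV"
  proof (rule summable_on_comparison_test)
    show "norm (case x of (k, l) \<Rightarrow> A i k * B k l * C l j) \<le> b * (case x of (k, l) \<Rightarrow> norm (A i k) * norm (C l j))" for x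
    proof (cases x)
      case (Pair k l)
      have "norm (B k l) * (norm (A i k) * norm (C l j)) \<le> b * (norm (A i k) * norm (C l j))"
        by (intro mult_right_mono b) simp
      thus ?thesis by (simp add: Pair norm_mult mult_ac)
    qed
  qed simp
  hence summ: "(\<lambda>(k, l). A i k * B k l * C l j) summable_on UNIV \<times> UNIV"
    using abs_summable_summable by simp
  have AB: "(\<lambda>k. A i k * B k l) summable_on UNIV" for l
    using A B mat_mult_cqt_matrix(2) by (auto simp: CQT_eq mat_mult_defined_def)
  have BC: "(\<lambda>l. B k l * C l j) summable_on UNIV" for k
    using B C mat_mult_cqt_matrix(2) by (auto simp: CQT_eq mat_mult_defined_def)
  have "mat_mult (mat_mult A B) C i j = (\<Sum>\<^sub>\<infinity>l. \<Sum>\<^sub>\<infinity>k. A i k * B k l * C l j)"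
    unfolding mat_mult_def by (intro infsum_cong infsum_cmult_left[symmetric] AB)
  also have "\<dots> = (\<Sum>\<^sub>\<infinity>k. \<Sum>\<^sub>\<infinity>l. A i k * B k l * C l j)"
    by (rule infsum_swap_banach[symmetric, OF summ])
  also have "\<dots> = mat_mult A (mat_mult B C) i j"
    unfolding mat_mult_def mult.assoc by (intro infsum_cong infsum_cmult_right BC)
  finally show "mat_mult (mat_mult A B) C i j = mat_mult A (mat_mult B C) i j" .
qed

lemma mat_mult_distrib_right:
  assumes "mat_mult_defined A C" "mat_mult_defined B C"
  shows "mat_mult (A + B) C = mat_mult A C + mat_mult B C"
  using assms unfolding mat_mult_def mat_mult_defined_def
  by (auto simp: fun_eq_iff distrib_right intro!: infsum_add)

lemma mat_mult_distrib_left: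
  assumes "mat_mult_defined A B" "mat_mult_defined A C"
  shows "mat_mult A (B + C) = mat_mult A B + mat_mult A C"
  using assms unfolding mat_mult_def mat_mult_defined_def
  by (auto simp: fun_eq_iff distrib_left intro!: infsum_add)

lemma mat_mult_scale:
  assumes "mat_mult_defined A B"
  shows "mat_mult (mat_scale c A) B = mat_scale c (mat_mult A B)"
    and "mat_mult A (mat_scale c B) = mat_scale c (mat_mult A B)"
  using assms unfolding mat_mult_def mat_mult_defined_def mat_scale_def
  by (auto simp: fun_eq_iff mult_ac simp flip: infsum_cmult_right)

lemma mat_mult_defined_CQT: "A \<in> CQT \<Longrightarrow> B \<in> CQT \<Longrightarrow> mat_mult_defined A B"
  using mat_mult_cqt_matrix(2) by (auto simp: CQT_eq)

lemma mat_mult_CQT: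
  assumes "A \<in> CQT" "B \<in> CQT"
  shows "mat_mult A B \<in> CQT" "cqt_norm (mat_mult A B) \<le> cqt_norm A * cqt_norm B"
  using assms
  by (auto simp: CQT_eq mat_mult_cqt_matrix cqt_norm_cqt_matrix cqt_conv)

lemma complex_banach_algebra_on_CQT: "complex_banach_algebra_on mat_scale CQT mat_mult cqt_norm"
proof -
  interpret vector_space mat_scale
    by unfold_locales (auto simp: mat_scale_def fun_eq_iff algebra_simps)
  show ?thesis
  proof
    show "subspace CQT"
    proof (rule subspaceI)
      show "0 \<in> CQT"
        unfolding CQT_eq using cqt_l1.wl1_0(1) cqt_matrix_0 by (metis image_eqI)
    next
      fix A B assume "A \<in> CQT" "B \<in> CQT"
      thus "A + B \<in> CQT"
        using cqt_l1.wl1_add(1) by (auto simp: CQT_eq simp flip: cqt_matrix_add)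
    next
      fix c A assume "A \<in> CQT"
      thus "mat_scale c A \<in> CQT"
        using cqt_l1.wl1_scale(1) by (auto simp: CQT_eq simp flip: cqt_matrix_scale)
    qed
    fix A B C assume A: "A \<in> CQT" and B: "B \<in> CQT" and C: "C \<in> CQT"
    obtain u v where u: "u \<in> wl1 cqt_weight" "A = cqt_matrix u" and v: "v \<in> wl1 cqt_weight" "B = cqt_matrix v"
      using A B by (auto simp: CQT_eq)
    show "mat_mult A B \<in> CQT" "cqt_norm (mat_mult A B) \<le> cqt_norm A * cqt_norm B"
      using mat_mult_CQT[OF A B] .
    show "mat_mult (mat_mult A B) C = mat_mult A (mat_mult B C)"
      using mat_mult_assoc_CQT[OF A B C] .
    show "mat_mult (A + B) C = mat_mult A C + mat_mult B C"
      "mat_mult A (B + C) = mat_mult A B + mat_mult A C"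
      by (intro mat_mult_distrib_right mat_mult_distrib_left mat_mult_defined_CQT A B C)+
    show "mat_mult (mat_scale c A) B = mat_scale c (mat_mult A B)"
      "mat_mult A (mat_scale c B) = mat_scale c (mat_mult A B)" for c
      by (intro mat_mult_scale mat_mult_defined_CQT A B)+
    show "0 \<le> cqt_norm A"
      using cqt_l1.wl1_norm_nonneg by (simp add: u cqt_norm_cqt_matrix)
    show "cqt_norm A = 0 \<longleftrightarrow> A = 0"
      using cqt_l1.wl1_norm_eq_0[OF u(1)] cqt_l1.wl1_0 cqt_matrix_eq_0[OF u(1)]
      by (auto simp: u cqt_norm_cqt_matrix cqt_matrix_0)
    show "cqt_norm (A + B) \<le> cqt_norm A + cqt_norm B"
      using cqt_l1.wl1_add[OF u(1) v(1)]
      by (simp add: u v cqt_norm_cqt_matrix flip: cqt_matrix_add)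
    show "cqt_norm (mat_scale c A) = norm c * cqt_norm A" for c
      using cqt_l1.wl1_scale[OF u(1)]
      by (simp add: u cqt_norm_cqt_matrix flip: cqt_matrix_scale)
  next
    fix X :: "nat \<Rightarrow> infmat"
    assume X_CQT: "\<And>n. X n \<in> CQT" and cauchy: "\<And>e. 0 < e \<Longrightarrow> \<exists>N. \<forall>m\<ge>N. \<forall>n\<ge>N. cqt_norm (X m - X n) < e"
    have "\<forall>n. \<exists>u. u \<in> wl1 cqt_weight \<and> X n = cqt_matrix u"
      using X_CQT unfolding CQT_eq by blast
    then obtain U where U: "\<And>n. U n \<in> wl1 cqt_weight" and X: "\<And>n. X n = cqt_matrix (U n)"
      by metis
    have norm_diff: "cqt_norm (X n - cqt_matrix v) = wl1_norm cqt_weight (U n - v)"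
      if "v \<in> wl1 cqt_weight" for n v
      using cqt_norm_cqt_matrix[OF cqt_l1.wl1_diff[OF U that]] by (simp add: X cqt_matrix_diff)
    have "\<exists>L\<in>wl1 cqt_weight. (\<lambda>n. wl1_norm cqt_weight (U n - L)) \<longlonglongrightarrow> 0"
    proof (rule cqt_l1.wl1_complete[OF U])
      show "\<exists>N. \<forall>m\<ge>N. \<forall>n\<ge>N. wl1_norm cqt_weight (U m - U n) < e" if "0 < e" for e
        using cauchy[OF that] norm_diff[OF U] by (simp add: X[symmetric])
    qed
    then obtain L where "L \<in> wl1 cqt_weight" "(\<lambda>n. wl1_norm cqt_weight (U n - L)) \<longlonglongrightarrow> 0"
      by blast
    thus "\<exists>L\<in>CQT. (\<lambda>n. cqt_norm (X n - L)) \<longlonglongrightarrow> 0"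
      by (intro bexI[of _ "cqt_matrix L"]) (simp_all add: norm_diff CQT_eq)
  qed
qed

theorem theorem3p7:
  shows "(\<forall>A\<in>CQT. \<forall>B\<in>CQT. mat_mult_defined A B) \<and>
         complex_banach_algebra_on mat_scale CQT mat_mult cqt_norm \<and>
         (\<forall>A\<in>CQT. \<forall>B\<in>CQT. cqt_norm (mat_mult A B) \<le> cqt_norm A * cqt_norm B)"
  using mat_mult_defined_CQT complex_banach_algebra_on_CQT mat_mult_CQT(2) by blast

end
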